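(* Let $r\ge 1$ be an integer, let $S$ be a fixed nonempty finite simplicial complex of dimension $\dim S\le r$, and let $\alpha=(\alpha_0,\alpha_1,\dots,\alpha_r)\in\mathbf{R}^{r+1}$ be a fixed vector with all $\alpha_i\ge 0$ (independent of $n$). 1. If $\alpha\in\tilde{\mathcal M}(S)$, then a random simplicial complex $Y\in Y_r(n,n^{-\alpha})$ contains $S$ as a simplicial subcomplex, a.a.s. 2. If $\alpha\notin \overline{\tilde{\mathcal M}(S)}$ (the closure of $\tilde{\mathcal M}(S)$ in $\mathbf{R}^{r+1}$), then a random simplicial complex $Y\in Y_r(n,n^{-\alpha})$ does not contain $S$ as a simplicial subcomplex, a.a.s.
   Context: Random complex: let $\Delta_n$ be the simplex with vertex set $\{1,\dots,n\}$, viewed as an abstract simplicial complex, and let $\Delta_n^{(r)}$ be its $r$-skeleton. For a subcomplex $Y\subset\Delta_n^{(r)}$ (the empty subcomplex is allowed) let $f_i(Y)$ be the number of $i$-dimensional simplexes of $Y$, and let $e_i(Y)$ be the number of $i$-dimensional external faces of $Y$, where an external face of $Y$ is a simplex $\sigma\subset\Delta_n$ with $\sigma\not\subset Y$ but $\partial\sigma\subset Y$ (the boundary of a vertex is empty, so $e_0(Y)=n-f_0(Y)$). For $\mathbf p=(p_0,\dots,p_r)$ with $0\le p_i\le 1$ and $q_i=1-p_i$, $Y_r(n;\mathbf p)$ denotes the probability space of all subcomplexes $Y\subset\Delta_n^{(r)}$ with probability function $\mathbb P_r(Y)=\prod_{i=0}^r p_i^{f_i(Y)}\prod_{i=0}^r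 q_i^{e_i(Y)}$ (convention $0^0=1$). For $\alpha=(\alpha_0,\dots,\alpha_r)$, $n^{-\alpha}$ denotes the multiparameter $\mathbf p=(n^{-\alpha_0},\dots,n^{-\alpha_r})$. "a.a.s." means with probability tending to $1$ as $n\to\infty$. "$Y$ contains $S$ as a simplicial subcomplex" means that $Y$ has a simplicial subcomplex isomorphic to $S$. Density domains: for a nonempty finite simplicial complex $T$ of dimension $\le r$ put $\mu_i(T)=f_0(T)/f_i(T)$ for $i=0,\dots,r$ (with $\mu_i(T)=\infty$ and $1/\mu_i(T)=0$ if $f_i(T)=0$; note $\mu_0(T)=1$). Define $\mathcal M(T)\subset\mathbf R^{r+1}$ as the set of $(\alpha_0,\dots,\alpha_r)$ with all $\alpha_i\ge 0$ and $\sum_{i=0}^r \alpha_i/\mu_i(T)<1$. Define $\tilde{\mathcal M}(S)=\bigcap_{T\subset S}\mathcal M(T)$, the intersection over all nonempty subcomplexes $T\subset S$ (including $T=S$). *)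

theory Defs
  imports "HOL-Analysis.Analysis"
begin

section \<open>Abstract simplicial complexes\<close>

text \<open>
  A complex is identified with its set of (nonempty, finite) simplexes. The empty simplex is
  excluded, so the empty complex is \<open>{}\<close>, and the vertex set of \<open>K\<close> is \<open>\<Union> K\<close>.
\<close>

definition abstract_simplicial_complex :: "'v set set \<Rightarrow> bool" where
  "abstract_simplicial_complex K \<longleftrightarrow>
     (\<forall>\<sigma>\<in>K. finite \<sigma> \<and> \<sigma> \<noteq> {}) \<and> (\<forall>\<sigma>\<in>K. \<forall>\<tau>. \<tau> \<subseteq> \<sigma> \<and> \<tau> \<noteq> {} \<longrightarrow> \<tau> \<in> K)"

definition subcomplex :: "'v set set \<Rightarrow> 'v set set \<Rightarrow> bool" where
  "subcomplex L K \<longleftrightarrow> abstract_simplicial_complex L \<and> L \<subseteq> K"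

text \<open>Only applied to nonempty simplexes, so the truncated subtraction is harmless.\<close>

definition simplex_dim :: "'v set \<Rightarrow> nat" where
  "simplex_dim \<sigma> = card \<sigma> - 1"

text \<open>Meaningful for nonempty finite complexes only.\<close>

definition complex_dim :: "'v set set \<Rightarrow> nat" where
  "complex_dim K = Max (simplex_dim ` K)"

definition skeleton :: "nat \<Rightarrow> 'v set set \<Rightarrow> 'v set set" where
  "skeleton r K = {\<sigma> \<in> K. simplex_dim \<sigma> \<le> r}"

definition boundary_faces :: "'v set \<Rightarrow> 'v set set" where
  "boundary_faces \<sigma> = {\<tau>. \<tau> \<subset> \<sigma> \<and> \<tau> \<noteq> {}}"

definition isomorphic_complexes :: "'v set set \<Rightarrow> 'w set set \<Rightarrow> bool" where
  "isomorphic_complexes K L \<longleftrightarrow>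
     (\<exists>\<phi>. bij_betw \<phi> (\<Union>K) (\<Union>L) \<and> (\<lambda>\<sigma>. \<phi> ` \<sigma>) ` K = L)"

definition contains_copy :: "'w set set \<Rightarrow> 'v set set \<Rightarrow> bool" where
  "contains_copy Y S \<longleftrightarrow> (\<exists>Z. subcomplex Z Y \<and> isomorphic_complexes S Z)"

definition face_count :: "nat \<Rightarrow> 'v set set \<Rightarrow> nat" where
  "face_count i K = card {\<sigma> \<in> K. simplex_dim \<sigma> = i}"


section \<open>The multi-parameter random simplicial complex\<close>

definition full_simplex :: "nat \<Rightarrow> nat set set" where
  "full_simplex n = Pow {1..n} - {{}}"

definition external_count :: "nat \<Rightarrow> nat \<Rightarrow> nat set set \<Rightarrow> nat" where
  "external_count n i Y =
     card {\<sigma> \<in> full_simplex n. simplex_dim \<sigma> = i \<and> \<sigma> \<notin> Y \<and> boundary_faces \<sigma> \<subseteq> Y}"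

definition complex_weight :: "nat \<Rightarrow> nat \<Rightarrow> (nat \<Rightarrow> real) \<Rightarrow> nat set set \<Rightarrow> real" where
  "complex_weight r n p Y =
     (\<Prod>i=0..r. p i ^ face_count i Y) * (\<Prod>i=0..r. (1 - p i) ^ external_count n i Y)"

definition random_complex :: "nat \<Rightarrow> nat \<Rightarrow> (nat \<Rightarrow> real) \<Rightarrow> nat set set measure" where
  "random_complex r n p =
     point_measure {Y. subcomplex Y (skeleton r (full_simplex n))}
       (\<lambda>Y. ennreal (complex_weight r n p Y))"

definition power_parameter :: "(nat \<Rightarrow> real) \<Rightarrow> nat \<Rightarrow> nat \<Rightarrow> real" where
  "power_parameter \<alpha> n = (\<lambda>i. real n powr (- \<alpha> i))"

definition asymptotically_almost_surely :: "(nat \<Rightarrow> 'a measure) \<Rightarrow> ('a \<Rightarrow> bool) \<Rightarrow> bool" where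
  "asymptotically_almost_surely M P \<longleftrightarrow>
     (\<lambda>n. measure (M n) {x \<in> space (M n). P x}) \<longlonglongrightarrow> 1"


section \<open>Density domains\<close>

definition vertex_face_ratio :: "nat \<Rightarrow> 'v set set \<Rightarrow> ereal" where
  "vertex_face_ratio i T =
     (if face_count i T = 0 then \<infinity> else ereal (real (face_count 0 T) / real (face_count i T)))"

text \<open>
  The space of vectors \<open>(\<alpha>\<^sub>0, \<dots>, \<alpha>\<^sub>r)\<close> is the library's \<open>Euclidean_space (Suc r)\<close>, whose points are the
  functions \<open>nat \<Rightarrow> real\<close> vanishing at all indices greater than \<open>r\<close>.
  The sum is taken in \<open>ereal\<close>, where \<open>x / \<infinity> = 0\<close> for real \<open>x\<close>.
\<close>

definition density_domain :: "nat \<Rightarrow> 'v set set \<Rightarrow> (nat \<Rightarrow> real) set" where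
  "density_domain r T =
     {\<alpha> \<in> topspace (Euclidean_space (Suc r)).
        (\<forall>i\<le>r. 0 \<le> \<alpha> i) \<and> (\<Sum>i=0..r. ereal (\<alpha> i) / vertex_face_ratio i T) < 1}"

definition reduced_density_domain :: "nat \<Rightarrow> 'v set set \<Rightarrow> (nat \<Rightarrow> real) set" where
  "reduced_density_domain r S = (\<Inter>T\<in>{T. subcomplex T S \<and> T \<noteq> {}}. density_domain r T)"

end

theory Submission
  imports Defs
begin

text \<open>
  The proof is the moment method, applied to the number \<open>X\<close> of injective maps \<open>\<phi>\<close> from the
  vertices of \<open>S\<close> to \<open>{1..n}\<close> whose image complex lies in \<open>Y\<close>.

  Everything rests on one formula: a fixed subcomplex \<open>L\<close> of the skeleton lies in \<open>Y\<close> with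
  probability \<open>\<Prod>\<sigma>\<in>L. p (dim \<sigma>)\<close> (\<open>sum_weight_containing\<close>). It becomes obvious after a
  coupling. Choose every face of the skeleton independently, a face of dimension \<open>i\<close> with
  probability \<open>p i\<close>, and let \<open>Y\<close> be the largest complex inside the chosen set \<open>A\<close>, its core. The
  core equals \<open>Y\<close> exactly when all faces of \<open>Y\<close> are chosen and all its external faces are not,
  which is the weight that defines the model; and \<open>L\<close> lies in the core exactly when \<open>L \<subseteq> A\<close>.

  Write \<open>v(T)\<close> for the number of vertices of \<open>T\<close> and \<open>w(T) = \<Sum>i. \<alpha> i * f\<^sub>i(T)\<close>. With
  \<open>p i = n powr - \<alpha> i\<close> the expected number of placements of \<open>T\<close> is of order \<open>n powr (v(T) - w(T))\<close>,
  and \<open>\<alpha>\<close> lies in the density domain of \<open>T\<close> iff \<open>w(T) < v(T)\<close>.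

  If \<open>\<alpha>\<close> is outside the closure of the reduced domain, then \<open>w(T) > v(T)\<close> for some \<open>T\<close>: otherwise
  all \<open>t * \<alpha>\<close> with \<open>0 \<le> t < 1\<close> would be in the domain and converge to \<open>\<alpha>\<close>
  (\<open>in_closure_reduced_density_domain\<close>). Markov's inequality then excludes copies of \<open>T\<close>, hence of \<open>S\<close>.

  If \<open>\<alpha>\<close> is in the reduced domain, Chebyshev's inequality gives \<open>X \<noteq> 0\<close>. Two placements
  \<open>\<phi>, \<psi>\<close> are correlated only through the overlap of their images, a copy of some subcomplex \<open>T\<close> of \<open>S\<close>,
  which raises the joint probability by a factor \<open>n powr w(T) \<le> n powr (v(T) - \<delta>)\<close>
  (\<open>pair_probability_le\<close>). Placements that share \<open>v(T)\<close> vertices form a fraction of order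
  \<open>n powr - v(T)\<close> of all pairs (\<open>sum_embeddings_overlap_le\<close>), so the relative variance is
  \<open>O(n powr - \<delta>)\<close>.
\<close>

section \<open>The random complex as the core of a Bernoulli set of faces\<close>

text \<open>
  The largest complex contained in \<open>A\<close>, provided that the members of \<open>A\<close> are finite and nonempty.
\<close>

definition complex_core :: "'v set set \<Rightarrow> 'v set set" where
  "complex_core A = {\<sigma> \<in> A. \<forall>\<tau>. \<tau> \<subseteq> \<sigma> \<and> \<tau> \<noteq> {} \<longrightarrow> \<tau> \<in> A}"

definition external_faces :: "'v set set \<Rightarrow> 'v set set \<Rightarrow> 'v set set" where
  "external_faces F Y = {\<sigma> \<in> F. \<sigma> \<notin> Y \<and> boundary_faces \<sigma> \<subseteq> Y}"

lemma complex_finite_nonempty: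
  assumes "abstract_simplicial_complex K" "\<sigma> \<in> K"
  shows "finite \<sigma>" "\<sigma> \<noteq> {}"
  using assms by (auto simp: abstract_simplicial_complex_def)

lemma complex_face_closed:
  assumes "abstract_simplicial_complex K" "\<sigma> \<in> K" "\<tau> \<subseteq> \<sigma>" "\<tau> \<noteq> {}"
  shows "\<tau> \<in> K"
  using assms unfolding abstract_simplicial_complex_def by blast

lemma abstract_simplicial_complexI:
  assumes "\<And>\<sigma>. \<sigma> \<in> K \<Longrightarrow> finite \<sigma> \<and> \<sigma> \<noteq> {}"
    and "\<And>\<sigma> \<tau>. \<sigma> \<in> K \<Longrightarrow> \<tau> \<subseteq> \<sigma> \<Longrightarrow> \<tau> \<noteq> {} \<Longrightarrow> \<tau> \<in> K"
  shows "abstract_simplicial_complex K"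
  using assms unfolding abstract_simplicial_complex_def by blast

lemma subset_complex_core_iff:
  assumes "abstract_simplicial_complex L"
  shows "L \<subseteq> complex_core A \<longleftrightarrow> L \<subseteq> A"
  using complex_face_closed[OF assms] unfolding complex_core_def by blast

lemma complex_core_is_complex:
  assumes "\<And>\<sigma>. \<sigma> \<in> A \<Longrightarrow> finite \<sigma> \<and> \<sigma> \<noteq> {}"
  shows "abstract_simplicial_complex (complex_core A)"
proof (rule abstract_simplicial_complexI)
  fix \<sigma> \<tau> assume "\<sigma> \<in> complex_core A" "\<tau> \<subseteq> \<sigma>" "\<tau> \<noteq> {}"
  then show "\<tau> \<in> complex_core A"
    unfolding complex_core_def using subset_trans by blast
qed (use assms in \<open>auto simp: complex_core_def\<close>)

text \<open>
  A smallest face of the core outside \<open>Y\<close> would have its whole boundary in \<open>Y\<close>, so it would be an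
  external face of \<open>Y\<close> that belongs to \<open>A\<close>. This identifies the fibres of the core map with events
  that prescribe the state of finitely many independent faces.
\<close>

lemma complex_core_eq_iff:
  assumes F: "\<And>\<sigma>. \<sigma> \<in> F \<Longrightarrow> finite \<sigma> \<and> \<sigma> \<noteq> {}" and "A \<subseteq> F"
    and Y: "abstract_simplicial_complex Y"
  shows "complex_core A = Y \<longleftrightarrow> Y \<subseteq> A \<and> A \<inter> external_faces F Y = {}"
proof
  assume core: "complex_core A = Y"
  have "Y \<subseteq> A" using core by (auto simp: complex_core_def)
  moreover have "\<sigma> \<in> Y" if "\<sigma> \<in> A" "boundary_faces \<sigma> \<subseteq> Y" for \<sigma>
  proof -
    have "\<tau> \<in> A" if "\<tau> \<subseteq> \<sigma>" "\<tau> \<noteq> {}" for \<tau>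
      using that \<open>\<sigma> \<in> A\<close> \<open>boundary_faces \<sigma> \<subseteq> Y\<close> \<open>Y \<subseteq> A\<close>
      unfolding boundary_faces_def by blast
    then show ?thesis using \<open>\<sigma> \<in> A\<close> core unfolding complex_core_def by blast
  qed
  ultimately show "Y \<subseteq> A \<and> A \<inter> external_faces F Y = {}"
    by (auto simp: external_faces_def)
next
  assume R: "Y \<subseteq> A \<and> A \<inter> external_faces F Y = {}"
  have "\<sigma> \<in> Y" if "\<sigma> \<in> complex_core A" for \<sigma>
  proof -
    have "finite \<sigma>" using that F \<open>A \<subseteq> F\<close> by (auto simp: complex_core_def)
    then show ?thesis using that
    proof (induction \<sigma> rule: finite_psubset_induct)
      case (psubset \<sigma>)
      have "\<tau> \<in> Y" if "\<tau> \<subset> \<sigma>" "\<tau> \<noteq> {}" for \<tau>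
      proof (rule psubset.IH[OF that(1)])
        show "\<tau> \<in> complex_core A"
          using psubset.prems that unfolding complex_core_def by blast
      qed
      then have "boundary_faces \<sigma> \<subseteq> Y" by (auto simp: boundary_faces_def)
      moreover have "\<sigma> \<in> A" using psubset.prems by (auto simp: complex_core_def)
      ultimately show ?case using R \<open>A \<subseteq> F\<close> by (auto simp: external_faces_def)
    qed
  qed
  then show "complex_core A = Y" using R subset_complex_core_iff[OF Y] by blast
qed

text \<open>
  In an independent choice of elements of \<open>F\<close>, the elements outside \<open>Y \<union> E\<close> are unconstrained and
  contribute a factor \<open>P a + (1 - P a) = 1\<close> each.
\<close>

lemma sum_bernoulli_prescribed:
  fixes P :: "'a \<Rightarrow> real"
  assumes "finite F" "Y \<subseteq> F" "E \<subseteq> F" "Y \<inter> E = {}"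
  shows "(\<Sum>A | A \<subseteq> F \<and> Y \<subseteq> A \<and> A \<inter> E = {}. (\<Prod>a\<in>A. P a) * (\<Prod>a\<in>F-A. 1 - P a))
       = (\<Prod>a\<in>Y. P a) * (\<Prod>a\<in>E. 1 - P a)"
proof -
  \<comment> \<open>Zero weights encode the constraints: a forbidden set \<open>A\<close> picks up a factor \<open>0\<close>.\<close>
  define f where "f a = (if a \<in> E then 0 else P a)" for a
  define g where "g a = (if a \<in> Y then 0 else 1 - P a)" for a
  have fin: "finite Y" "finite E" using assms finite_subset by blast+
  have "(\<Prod>a\<in>A. f a) * (\<Prod>a\<in>F-A. g a) =
      (if Y \<subseteq> A \<and> A \<inter> E = {} then (\<Prod>a\<in>A. P a) * (\<Prod>a\<in>F-A. 1 - P a) else 0)"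
    if "A \<subseteq> F" for A
  proof (cases "Y \<subseteq> A \<and> A \<inter> E = {}")
    case True
    have "(\<Prod>a\<in>A. f a) = (\<Prod>a\<in>A. P a)" "(\<Prod>a\<in>F-A. g a) = (\<Prod>a\<in>F-A. 1 - P a)"
      using True by (auto intro!: prod.cong simp: f_def g_def)
    then show ?thesis using True by simp
  next
    case False
    have "finite A" using that assms(1) finite_subset by blast
    from False have "(\<exists>a\<in>F-A. g a = 0) \<or> (\<exists>a\<in>A. f a = 0)"
      using assms(2) by (auto simp: f_def g_def)
    then show ?thesis using False \<open>finite A\<close> \<open>finite F\<close> by (auto simp: prod_zero_iff)
  qed
  then have "(\<Prod>a\<in>F. f a + g a) = (\<Sum>A\<in>Pow F.
      (if Y \<subseteq> A \<and> A \<inter> E = {} then (\<Prod>a\<in>A. P a) * (\<Prod>a\<in>F-A. 1 - P a) else 0))"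
    unfolding prod_add[OF \<open>finite F\<close>] by (intro sum.cong) auto
  also have "\<dots> = (\<Sum>A | A \<subseteq> F \<and> Y \<subseteq> A \<and> A \<inter> E = {}. (\<Prod>a\<in>A. P a) * (\<Prod>a\<in>F-A. 1 - P a))"
    using \<open>finite F\<close> by (simp add: sum.If_cases Int_def)
  finally have "(\<Sum>A | A \<subseteq> F \<and> Y \<subseteq> A \<and> A \<inter> E = {}. (\<Prod>a\<in>A. P a) * (\<Prod>a\<in>F-A. 1 - P a))
      = (\<Prod>a\<in>F. f a + g a)" by simp
  also have "\<dots> = (\<Prod>a\<in>Y \<union> E. f a + g a)"
    using assms by (intro prod.mono_neutral_right) (auto simp: f_def g_def)
  also have "\<dots> = (\<Prod>a\<in>Y. f a + g a) * (\<Prod>a\<in>E. f a + g a)"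
    by (rule prod.union_disjoint) (use fin assms in auto)
  also have "(\<Prod>a\<in>Y. f a + g a) = (\<Prod>a\<in>Y. P a)"
    using assms(4) by (intro prod.cong) (auto simp: f_def g_def)
  also have "(\<Prod>a\<in>E. f a + g a) = (\<Prod>a\<in>E. 1 - P a)"
    using assms(4) by (intro prod.cong) (auto simp: f_def g_def)
  finally show ?thesis .
qed

lemma prod_by_simplex_dim:
  fixes h :: "nat \<Rightarrow> real"
  assumes "finite L" "\<And>\<sigma>. \<sigma> \<in> L \<Longrightarrow> simplex_dim \<sigma> \<le> r"
  shows "(\<Prod>i=0..r. h i ^ card {\<sigma> \<in> L. simplex_dim \<sigma> = i}) = (\<Prod>\<sigma>\<in>L. h (simplex_dim \<sigma>))"
proof -
  have "(\<Prod>i=0..r. \<Prod>\<sigma> | \<sigma> \<in> L \<and> simplex_dim \<sigma> = i. h (simplex_dim \<sigma>))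
      = (\<Prod>\<sigma>\<in>L. h (simplex_dim \<sigma>))"
    using assms by (intro prod.group) auto
  then show ?thesis by simp
qed

definition skeleton_subcomplexes :: "nat \<Rightarrow> nat \<Rightarrow> nat set set set" where
  "skeleton_subcomplexes r n = {Y. subcomplex Y (skeleton r (full_simplex n))}"

lemma finite_full_simplex: "finite (full_simplex n)"
  by (simp add: full_simplex_def)

lemma finite_skeleton: "finite (skeleton r (full_simplex n))"
  by (simp add: skeleton_def finite_full_simplex)

lemma skeleton_face_finite_nonempty:
  assumes "\<sigma> \<in> skeleton r (full_simplex n)"
  shows "finite \<sigma> \<and> \<sigma> \<noteq> {}"
  using assms finite_subset[of \<sigma> "{1..n}"] by (auto simp: skeleton_def full_simplex_def)

lemma finite_skeleton_subcomplexes: "finite (skeleton_subcomplexes r n)"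
proof (rule finite_subset)
  show "skeleton_subcomplexes r n \<subseteq> Pow (skeleton r (full_simplex n))"
    by (auto simp: skeleton_subcomplexes_def subcomplex_def)
qed (simp add: finite_skeleton)

lemma skeleton_subcomplexes_Un:
  assumes "K \<in> skeleton_subcomplexes r n" "L \<in> skeleton_subcomplexes r n"
  shows "K \<union> L \<in> skeleton_subcomplexes r n"
proof -
  have K: "abstract_simplicial_complex K" "K \<subseteq> skeleton r (full_simplex n)"
    and L: "abstract_simplicial_complex L" "L \<subseteq> skeleton r (full_simplex n)"
    using assms by (simp_all add: skeleton_subcomplexes_def subcomplex_def)
  have "abstract_simplicial_complex (K \<union> L)"
  proof (rule abstract_simplicial_complexI)
    fix \<sigma> assume "\<sigma> \<in> K \<union> L"
    then show "finite \<sigma> \<and> \<sigma> \<noteq> {}"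
      using complex_finite_nonempty[OF K(1)] complex_finite_nonempty[OF L(1)] by blast
  next
    fix \<sigma> \<tau> assume "\<sigma> \<in> K \<union> L" "\<tau> \<subseteq> \<sigma>" "\<tau> \<noteq> {}"
    then show "\<tau> \<in> K \<union> L"
      using complex_face_closed[OF K(1)] complex_face_closed[OF L(1)] by (elim UnE) simp_all
  qed
  then show ?thesis using K(2) L(2) by (simp add: skeleton_subcomplexes_def subcomplex_def)
qed

lemma complex_weight_eq:
  assumes "Y \<in> skeleton_subcomplexes r n"
  shows "complex_weight r n p Y = (\<Prod>\<sigma>\<in>Y. p (simplex_dim \<sigma>)) *
    (\<Prod>\<sigma>\<in>external_faces (skeleton r (full_simplex n)) Y. 1 - p (simplex_dim \<sigma>))"
proof -
  let ?E = "external_faces (skeleton r (full_simplex n)) Y"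
  have Y: "Y \<subseteq> skeleton r (full_simplex n)"
    using assms by (simp add: skeleton_subcomplexes_def subcomplex_def)
  have E: "?E \<subseteq> skeleton r (full_simplex n)" by (auto simp: external_faces_def)
  have "(\<Prod>i=0..r. p i ^ face_count i Y) = (\<Prod>\<sigma>\<in>Y. p (simplex_dim \<sigma>))"
    unfolding face_count_def
    by (rule prod_by_simplex_dim)
      (use Y finite_subset[OF Y finite_skeleton] in \<open>auto simp: skeleton_def\<close>)
  moreover have "external_count n i Y = card {\<sigma> \<in> ?E. simplex_dim \<sigma> = i}" if "i \<le> r" for i
    unfolding external_count_def
    by (rule arg_cong[of _ _ card]) (use that in \<open>auto simp: external_faces_def skeleton_def\<close>)
  then have "(\<Prod>i=0..r. (1 - p i) ^ external_count n i Y)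
      = (\<Prod>i=0..r. (1 - p i) ^ card {\<sigma> \<in> ?E. simplex_dim \<sigma> = i})"
    by (intro prod.cong) auto
  moreover have "\<dots> = (\<Prod>\<sigma>\<in>?E. 1 - p (simplex_dim \<sigma>))"
    by (rule prod_by_simplex_dim[where h = "\<lambda>i. 1 - p i"])
      (use E finite_subset[OF E finite_skeleton] in \<open>auto simp: skeleton_def\<close>)
  ultimately show ?thesis by (simp add: complex_weight_def)
qed

text \<open>
  Group the sets \<open>A\<close> of chosen faces by their core: each weight is the total Bernoulli weight of a
  fibre, and the fibres over the complexes that contain \<open>L\<close> make up \<open>{A. L \<subseteq> A}\<close>.
\<close>

lemma sum_weight_containing:
  assumes L: "L \<in> skeleton_subcomplexes r n"
  shows "(\<Sum>Y | Y \<in> skeleton_subcomplexes r n \<and> L \<subseteq> Y. complex_weight r n p Y)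
       = (\<Prod>\<sigma>\<in>L. p (simplex_dim \<sigma>))"
proof -
  define F where "F = skeleton r (full_simplex n)"
  define P where "P \<sigma> = p (simplex_dim \<sigma>)" for \<sigma> :: "nat set"
  define w where "w A = (\<Prod>a\<in>A. P a) * (\<Prod>a\<in>F-A. 1 - P a)" for A
  define T where "T = {Y \<in> skeleton_subcomplexes r n. L \<subseteq> Y}"
  define U where "U = {A. A \<subseteq> F \<and> L \<subseteq> A \<and> A \<inter> {} = {}}"
  have F: "finite F" "\<And>\<sigma>. \<sigma> \<in> F \<Longrightarrow> finite \<sigma> \<and> \<sigma> \<noteq> {}"
    using finite_skeleton skeleton_face_finite_nonempty by (auto simp: F_def)
  have L': "abstract_simplicial_complex L" "L \<subseteq> F"
    using L by (auto simp: skeleton_subcomplexes_def subcomplex_def F_def)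
  have "complex_weight r n p Y = (\<Sum>A | A \<in> U \<and> complex_core A = Y. w A)" if "Y \<in> T" for Y
  proof -
    have Y: "abstract_simplicial_complex Y" "Y \<subseteq> F" "L \<subseteq> Y"
      using that by (auto simp: T_def skeleton_subcomplexes_def subcomplex_def F_def)
    have "complex_weight r n p Y = (\<Prod>\<sigma>\<in>Y. P \<sigma>) * (\<Prod>\<sigma>\<in>external_faces F Y. 1 - P \<sigma>)"
      using that complex_weight_eq by (simp add: T_def P_def F_def)
    also have "\<dots> = (\<Sum>A | A \<subseteq> F \<and> Y \<subseteq> A \<and> A \<inter> external_faces F Y = {}. w A)"
      unfolding w_def
      by (rule sum_bernoulli_prescribed[symmetric]) (use F Y in \<open>auto simp: external_faces_def\<close>)
    also have "{A. A \<subseteq> F \<and> Y \<subseteq> A \<and> A \<inter> external_faces F Y = {}}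
        = {A. A \<in> U \<and> complex_core A = Y}"
      using complex_core_eq_iff[OF F(2) _ Y(1)] Y(3) by (auto simp: U_def)
    finally show ?thesis .
  qed
  then have "(\<Sum>Y\<in>T. complex_weight r n p Y)
      = (\<Sum>Y\<in>T. \<Sum>A | A \<in> U \<and> complex_core A = Y. w A)" by (rule sum.cong[OF refl])
  also have "\<dots> = (\<Sum>A\<in>U. w A)"
  proof (rule sum.group)
    show "finite U" using F(1) by (simp add: U_def)
    show "finite T" by (simp add: T_def finite_skeleton_subcomplexes)
    show "complex_core ` U \<subseteq> T"
    proof (rule image_subsetI)
      fix A assume "A \<in> U"
      then have A: "A \<subseteq> F" "L \<subseteq> A" by (auto simp: U_def)
      have "abstract_simplicial_complex (complex_core A)"
        by (rule complex_core_is_complex) (use A F(2) in blast)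
      moreover have "complex_core A \<subseteq> F" using A by (auto simp: complex_core_def)
      ultimately show "complex_core A \<in> T"
        using A subset_complex_core_iff[OF L'(1)]
        by (simp add: T_def skeleton_subcomplexes_def subcomplex_def F_def)
    qed
  qed
  also have "\<dots> = (\<Prod>a\<in>L. P a) * (\<Prod>a\<in>{}. 1 - P a)"
    unfolding U_def w_def by (rule sum_bernoulli_prescribed) (use F L' in auto)
  finally show ?thesis by (simp add: T_def P_def)
qed

lemma complex_weight_nonneg:
  assumes "\<And>i. i \<le> r \<Longrightarrow> 0 \<le> p i \<and> p i \<le> 1"
  shows "0 \<le> complex_weight r n p Y"
  unfolding complex_weight_def using assms by (intro mult_nonneg_nonneg prod_nonneg) auto

lemma measure_random_complex:
  assumes "\<And>i. i \<le> r \<Longrightarrow> 0 \<le> p i \<and> p i \<le> 1"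
  shows "measure (random_complex r n p) {Y \<in> space (random_complex r n p). Q Y}
       = (\<Sum>Y | Y \<in> skeleton_subcomplexes r n \<and> Q Y. complex_weight r n p Y)"
proof -
  have "measure (point_measure (skeleton_subcomplexes r n) (complex_weight r n p))
      {Y \<in> skeleton_subcomplexes r n. Q Y}
      = (\<Sum>Y | Y \<in> skeleton_subcomplexes r n \<and> Q Y. complex_weight r n p Y)"
    using measure_point_measure_finite_if[OF finite_skeleton_subcomplexes]
      complex_weight_nonneg[OF assms] by auto
  then show ?thesis
    by (simp add: random_complex_def skeleton_subcomplexes_def space_point_measure)
qed

lemma sum_weight_total:
  "(\<Sum>Y\<in>skeleton_subcomplexes r n. complex_weight r n p Y) = 1"
proof -
  have "{} \<in> skeleton_subcomplexes r n"
    by (simp add: skeleton_subcomplexes_def subcomplex_def abstract_simplicial_complex_def)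
  from sum_weight_containing[OF this] show ?thesis by simp
qed

lemma measure_random_complex_not:
  assumes "\<And>i. i \<le> r \<Longrightarrow> 0 \<le> p i \<and> p i \<le> 1"
  shows "measure (random_complex r n p) {Y \<in> space (random_complex r n p). \<not> Q Y}
       = 1 - measure (random_complex r n p) {Y \<in> space (random_complex r n p). Q Y}"
proof -
  let ?K = "skeleton_subcomplexes r n" and ?w = "complex_weight r n p"
  have "sum ?w ?K = sum ?w {Y \<in> ?K. Q Y} + sum ?w {Y \<in> ?K. \<not> Q Y}"
    by (subst sum.union_disjoint[symmetric])
      (auto simp: finite_skeleton_subcomplexes intro: sum.cong)
  then show ?thesis
    using measure_random_complex[where Q = Q, OF assms]
      measure_random_complex[where Q = "\<lambda>Y. \<not> Q Y", OF assms] sum_weight_total[of r n p]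
    by auto
qed

section \<open>Copies as injective placements of the vertices\<close>

text \<open>
  Extensional functions make the set finite and make each placement of the vertices count once.
  A subcomplex of \<open>Y\<close> is counted once for each automorphism of the complex that it is a copy of, a
  constant factor that cancels in the ratios of moments.
\<close>

definition vertex_embeddings :: "'v set \<Rightarrow> nat \<Rightarrow> ('v \<Rightarrow> nat) set" where
  "vertex_embeddings V n = {\<phi> \<in> V \<rightarrow>\<^sub>E {1..n}. inj_on \<phi> V}"

lemma finite_vertex_embeddings: "finite V \<Longrightarrow> finite (vertex_embeddings V n)"
  by (simp add: vertex_embeddings_def finite_PiE)

lemma embedding_image_complex:
  assumes "abstract_simplicial_complex K"
  shows "abstract_simplicial_complex ((`) \<phi> ` K)"
proof (rule abstract_simplicial_complexI)
  fix \<sigma> assume "\<sigma> \<in> (`) \<phi> ` K"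
  then show "finite \<sigma> \<and> \<sigma> \<noteq> {}" using complex_finite_nonempty[OF assms] by auto
next
  fix \<sigma> \<tau> assume "\<sigma> \<in> (`) \<phi> ` K" and \<tau>: "\<tau> \<subseteq> \<sigma>" "\<tau> \<noteq> {}"
  then obtain \<rho> where \<rho>: "\<rho> \<in> K" "\<sigma> = \<phi> ` \<rho>" by auto
  define \<rho>' where "\<rho>' = {u \<in> \<rho>. \<phi> u \<in> \<tau>}"
  have "\<tau> = \<phi> ` \<rho>'" using \<tau> \<rho> by (auto simp: \<rho>'_def)
  moreover have "\<rho>' \<subseteq> \<rho>" by (auto simp: \<rho>'_def)
  moreover have "\<rho>' \<noteq> {}" using \<open>\<tau> = \<phi> ` \<rho>'\<close> \<tau>(2) by blast
  ultimately have "\<tau> = \<phi> ` \<rho>'" "\<rho>' \<in> K" using complex_face_closed[OF assms \<rho>(1)] by blast+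
  then show "\<tau> \<in> (`) \<phi> ` K" by blast
qed

lemma inj_on_image_faces:
  assumes "inj_on \<phi> (\<Union>K)"
  shows "inj_on ((`) \<phi>) K"
  using assms by (intro inj_onI) (metis Union_upper inj_on_image_eq_iff)

lemma simplex_dim_image:
  assumes "inj_on \<phi> (\<Union>K)" "\<sigma> \<in> K"
  shows "simplex_dim (\<phi> ` \<sigma>) = simplex_dim \<sigma>"
  unfolding simplex_dim_def
  by (subst card_image) (use assms in \<open>auto intro: inj_on_subset\<close>)

lemma embedding_image_subcomplex:
  assumes "abstract_simplicial_complex K" "\<And>\<sigma>. \<sigma> \<in> K \<Longrightarrow> simplex_dim \<sigma> \<le> r"
    and "\<phi> \<in> vertex_embeddings (\<Union>K) n"
  shows "(`) \<phi> ` K \<in> skeleton_subcomplexes r n"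
proof -
  have inj: "inj_on \<phi> (\<Union>K)" using assms(3) by (simp add: vertex_embeddings_def)
  have "\<phi> ` \<sigma> \<in> skeleton r (full_simplex n)" if "\<sigma> \<in> K" for \<sigma>
    using that assms simplex_dim_image[OF inj that] complex_finite_nonempty[OF assms(1) that]
    by (auto simp: skeleton_def full_simplex_def vertex_embeddings_def PiE_iff)
  then show ?thesis
    using embedding_image_complex[OF assms(1)]
    by (auto simp: skeleton_subcomplexes_def subcomplex_def)
qed

lemma contains_copy_iff_embedding:
  assumes S: "abstract_simplicial_complex S" and Y: "Y \<in> skeleton_subcomplexes r n"
  shows "contains_copy Y S \<longleftrightarrow> (\<exists>\<phi>\<in>vertex_embeddings (\<Union>S) n. (`) \<phi> ` S \<subseteq> Y)"
proof
  assume "contains_copy Y S"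
  then obtain Z \<phi> where Z: "Z \<subseteq> Y" and bij: "bij_betw \<phi> (\<Union>S) (\<Union>Z)" and im: "(`) \<phi> ` S = Z"
    by (auto simp: contains_copy_def subcomplex_def isomorphic_complexes_def)
  have "\<Union>Y \<subseteq> {1..n}"
    using Y by (auto simp: skeleton_subcomplexes_def subcomplex_def skeleton_def full_simplex_def)
  then have "\<phi> ` \<Union>S \<subseteq> {1..n}" using bij Z by (auto simp: bij_betw_def)
  moreover have "inj_on (restrict \<phi> (\<Union>S)) (\<Union>S)"
    using bij by (auto simp: bij_betw_def inj_on_def)
  ultimately have "restrict \<phi> (\<Union>S) \<in> vertex_embeddings (\<Union>S) n"
    by (auto simp: vertex_embeddings_def)
  moreover have "restrict \<phi> (\<Union>S) ` \<sigma> = \<phi> ` \<sigma>" if "\<sigma> \<in> S" for \<sigma>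
    using that by (intro image_cong) auto
  then have "(`) (restrict \<phi> (\<Union>S)) ` S \<subseteq> Y" using im Z by auto
  ultimately show "\<exists>\<phi>\<in>vertex_embeddings (\<Union>S) n. (`) \<phi> ` S \<subseteq> Y" by blast
next
  assume "\<exists>\<phi>\<in>vertex_embeddings (\<Union>S) n. (`) \<phi> ` S \<subseteq> Y"
  then obtain \<phi> where \<phi>: "\<phi> \<in> vertex_embeddings (\<Union>S) n" "(`) \<phi> ` S \<subseteq> Y" by blast
  have "subcomplex ((`) \<phi> ` S) Y"
    using \<phi> embedding_image_complex[OF S] by (auto simp: subcomplex_def)
  moreover have "bij_betw \<phi> (\<Union>S) (\<Union>((`) \<phi> ` S))"
    using \<phi> by (auto simp: bij_betw_def vertex_embeddings_def)
  ultimately show "contains_copy Y S"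
    by (auto simp: contains_copy_def isomorphic_complexes_def)
qed

lemma contains_copy_mono:
  assumes "abstract_simplicial_complex S" "subcomplex T S" "Y \<in> skeleton_subcomplexes r n"
    and "contains_copy Y S"
  shows "contains_copy Y T"
proof -
  have T: "abstract_simplicial_complex T" "T \<subseteq> S" using assms(2) by (auto simp: subcomplex_def)
  obtain \<phi> where \<phi>: "\<phi> \<in> vertex_embeddings (\<Union>S) n" "(`) \<phi> ` S \<subseteq> Y"
    using assms(4) contains_copy_iff_embedding[OF assms(1,3)] by blast
  have sub: "subcomplex ((`) \<phi> ` T) Y"
    using \<phi> T embedding_image_complex[OF T(1)] by (auto simp: subcomplex_def)
  have "inj_on \<phi> (\<Union>T)"
    using \<phi>(1) T(2) by (auto simp: vertex_embeddings_def intro: inj_on_subset)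
  then have "bij_betw \<phi> (\<Union>T) (\<Union>((`) \<phi> ` T))" by (auto simp: bij_betw_def)
  with sub show ?thesis by (auto simp: contains_copy_def isomorphic_complexes_def)
qed

lemma face_count_zero_eq_card_vertices:
  assumes "abstract_simplicial_complex K"
  shows "face_count 0 K = card (\<Union>K)"
proof -
  have "{\<sigma> \<in> K. simplex_dim \<sigma> = 0} = (\<lambda>v. {v}) ` \<Union>K"
  proof (intro equalityI subsetI)
    fix \<sigma> assume "\<sigma> \<in> {\<sigma> \<in> K. simplex_dim \<sigma> = 0}"
    then have "\<sigma> \<in> K" "card \<sigma> \<le> 1" by (auto simp: simplex_dim_def)
    moreover have "card \<sigma> \<noteq> 0" using complex_finite_nonempty[OF assms \<open>\<sigma> \<in> K\<close>] by auto
    ultimately have "card \<sigma> = 1" by linarith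
    then show "\<sigma> \<in> (\<lambda>v. {v}) ` \<Union>K" using \<open>\<sigma> \<in> K\<close> by (auto simp: card_1_singleton_iff)
  next
    fix \<sigma> assume "\<sigma> \<in> (\<lambda>v. {v}) ` \<Union>K"
    then show "\<sigma> \<in> {\<sigma> \<in> K. simplex_dim \<sigma> = 0}"
      using complex_face_closed[OF assms] by (auto simp: simplex_dim_def)
  qed
  then show ?thesis by (simp add: face_count_def card_image)
qed

lemma prod_embedding_image:
  assumes "inj_on \<phi> (\<Union>K)"
  shows "(\<Prod>\<sigma>\<in>(`) \<phi> ` K. p (simplex_dim \<sigma>)) = (\<Prod>\<sigma>\<in>K. p (simplex_dim \<sigma>) :: real)"
  using simplex_dim_image[OF assms] by (simp add: prod.reindex[OF inj_on_image_faces[OF assms]])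

section \<open>The first moment\<close>

lemma card_vertex_embeddings_le:
  assumes "finite V"
  shows "card (vertex_embeddings V n) \<le> n ^ card V"
proof -
  have "card (vertex_embeddings V n) \<le> card (V \<rightarrow>\<^sub>E {1..n})"
    by (rule card_mono) (auto simp: vertex_embeddings_def finite_PiE assms)
  then show ?thesis by (simp add: card_PiE assms)
qed

definition embedding_count :: "'v set set \<Rightarrow> nat \<Rightarrow> nat set set \<Rightarrow> real" where
  "embedding_count S n Y = (\<Sum>\<phi>\<in>vertex_embeddings (\<Union>S) n. of_bool ((`) \<phi> ` S \<subseteq> Y))"

lemma embedding_count_nonneg: "0 \<le> embedding_count S n Y"
  by (simp add: embedding_count_def sum_nonneg)

lemma embedding_count_ge_1:
  assumes "finite (\<Union>S)" "abstract_simplicial_complex S" "Y \<in> skeleton_subcomplexes r n"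
    and "contains_copy Y S"
  shows "1 \<le> embedding_count S n Y"
proof -
  obtain \<phi> where "\<phi> \<in> vertex_embeddings (\<Union>S) n" "(`) \<phi> ` S \<subseteq> Y"
    using assms contains_copy_iff_embedding by blast
  then show ?thesis
    unfolding embedding_count_def
    using member_le_sum[of \<phi> "vertex_embeddings (\<Union>S) n" "\<lambda>\<phi>. of_bool ((`) \<phi> ` S \<subseteq> Y) :: real"]
      finite_vertex_embeddings[OF assms(1)] by auto
qed

lemma embedding_count_eq_0:
  assumes "abstract_simplicial_complex S" "Y \<in> skeleton_subcomplexes r n" "\<not> contains_copy Y S"
  shows "embedding_count S n Y = 0"
  unfolding embedding_count_def
  by (rule sum.neutral) (use assms contains_copy_iff_embedding[OF assms(1,2)] in auto)

lemma mean_embedding_count: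
  assumes S: "abstract_simplicial_complex S" "\<And>\<sigma>. \<sigma> \<in> S \<Longrightarrow> simplex_dim \<sigma> \<le> r"
  shows "(\<Sum>Y\<in>skeleton_subcomplexes r n. complex_weight r n p Y * embedding_count S n Y)
       = real (card (vertex_embeddings (\<Union>S) n)) * (\<Prod>\<sigma>\<in>S. p (simplex_dim \<sigma>))"
proof -
  let ?K = "skeleton_subcomplexes r n" and ?w = "complex_weight r n p"
  let ?E = "vertex_embeddings (\<Union>S) n"
  have "(\<Sum>Y\<in>?K. ?w Y * embedding_count S n Y)
      = (\<Sum>\<phi>\<in>?E. \<Sum>Y\<in>?K. ?w Y * of_bool ((`) \<phi> ` S \<subseteq> Y))"
    unfolding embedding_count_def sum_distrib_left by (rule sum.swap)
  also have "\<dots> = (\<Sum>\<phi>\<in>?E. \<Prod>\<sigma>\<in>S. p (simplex_dim \<sigma>))"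
  proof (rule sum.cong[OF refl])
    fix \<phi> assume \<phi>: "\<phi> \<in> ?E"
    then have "inj_on \<phi> (\<Union>S)" by (simp add: vertex_embeddings_def)
    then show "(\<Sum>Y\<in>?K. ?w Y * of_bool ((`) \<phi> ` S \<subseteq> Y)) = (\<Prod>\<sigma>\<in>S. p (simplex_dim \<sigma>))"
      using sum_weight_containing[OF embedding_image_subcomplex[OF S \<phi>]]
      by (simp add: finite_skeleton_subcomplexes prod_embedding_image Int_def)
  qed
  finally show ?thesis by simp
qed

text \<open>
  Markov's inequality: a copy makes the number of embeddings at least \<open>1\<close>.
\<close>

lemma first_moment_bound:
  assumes S: "abstract_simplicial_complex S" "finite S" "\<And>\<sigma>. \<sigma> \<in> S \<Longrightarrow> simplex_dim \<sigma> \<le> r"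
    and p: "\<And>i. i \<le> r \<Longrightarrow> 0 \<le> p i \<and> p i \<le> 1"
  shows "measure (random_complex r n p) {Y \<in> space (random_complex r n p). contains_copy Y S}
       \<le> real n ^ card (\<Union>S) * (\<Prod>\<sigma>\<in>S. p (simplex_dim \<sigma>))"
proof -
  let ?K = "skeleton_subcomplexes r n" and ?w = "complex_weight r n p"
  have finV: "finite (\<Union>S)" using S complex_finite_nonempty[OF S(1)] by blast
  have "(\<Sum>Y | Y \<in> ?K \<and> contains_copy Y S. ?w Y) = (\<Sum>Y\<in>?K. ?w Y * of_bool (contains_copy Y S))"
    by (simp add: finite_skeleton_subcomplexes Int_def)
  also have "\<dots> \<le> (\<Sum>Y\<in>?K. ?w Y * embedding_count S n Y)"
    using embedding_count_ge_1[OF finV S(1)] embedding_count_nonneg[of S n]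
    by (intro sum_mono mult_left_mono complex_weight_nonneg p) (auto simp: of_bool_def)
  also have "\<dots> = real (card (vertex_embeddings (\<Union>S) n)) * (\<Prod>\<sigma>\<in>S. p (simplex_dim \<sigma>))"
    by (rule mean_embedding_count[OF S(1,3)])
  also have "\<dots> \<le> real n ^ card (\<Union>S) * (\<Prod>\<sigma>\<in>S. p (simplex_dim \<sigma>))"
    using card_vertex_embeddings_le[OF finV, of n] S(3) p
    by (intro mult_right_mono prod_nonneg) (auto simp flip: of_nat_power)
  finally show ?thesis by (simp add: measure_random_complex[OF p])
qed

section \<open>The second moment\<close>

text \<open>
  Cut \<open>{1..n}\<close> into \<open>card V\<close> consecutive blocks of length \<open>m = n div card V \<ge> n / (2 * card V)\<close> and
  send each vertex into a block of its own. Such maps are automatically injective, and there are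
  \<open>m ^ card V\<close> of them.
\<close>

lemma card_vertex_embeddings_ge:
  assumes "finite V" "card V \<le> n"
  shows "(real n / (2 * card V)) ^ card V \<le> real (card (vertex_embeddings V n))"
proof -
  obtain e where e: "bij_betw e V {0..<card V}" using ex_bij_betw_finite_nat[OF assms(1)] by blast
  define m where "m = n div card V"
  define G where "G = (\<Pi>\<^sub>E u\<in>V. {e u * m + 1..e u * m + m})"
  have "G \<subseteq> vertex_embeddings V n"
  proof
    fix \<phi> assume \<phi>: "\<phi> \<in> G"
    have block: "(\<phi> u - 1) div m = e u" "1 \<le> \<phi> u" "\<phi> u \<le> n" if "u \<in> V" for u
    proof -
      have b: "e u * m + 1 \<le> \<phi> u" "\<phi> u \<le> e u * m + m"
        using \<phi> that by (auto simp: G_def PiE_iff)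
      show "1 \<le> \<phi> u" using b by simp
      have "e u < card V" using e that by (auto simp: bij_betw_def)
      then have "(e u + 1) * m \<le> card V * m" by (intro mult_right_mono) auto
      also have "\<dots> \<le> n" by (simp add: m_def)
      finally show "\<phi> u \<le> n" using b by simp
      have "m * e u + 1 \<le> \<phi> u" "\<phi> u \<le> m * e u + m" using b by (simp_all add: mult.commute)
      then show "(\<phi> u - 1) div m = e u" by (intro div_nat_eqI) auto
    qed
    have "inj_on \<phi> V"
    proof (rule inj_onI)
      fix x y assume "x \<in> V" "y \<in> V" "\<phi> x = \<phi> y"
      then have "e x = e y" using block(1) by metis
      then show "x = y" using e \<open>x \<in> V\<close> \<open>y \<in> V\<close> by (auto simp: bij_betw_def inj_on_def)
    qed
    then show "\<phi> \<in> vertex_embeddings V n"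
      using \<phi> block by (auto simp: vertex_embeddings_def G_def PiE_iff)
  qed
  then have "card G \<le> card (vertex_embeddings V n)"
    by (intro card_mono finite_vertex_embeddings assms)
  moreover have "card G = m ^ card V"
    using assms by (simp add: G_def card_PiE)
  moreover have "real n / (2 * card V) \<le> real m"
  proof (cases "card V = 0")
    case False
    then have "1 \<le> m" using assms by (simp add: m_def Suc_le_eq div_greater_zero_iff del: card_0_eq)
    have "n < (m + 1) * card V"
      using False by (simp add: m_def dividend_less_times_div algebra_simps)
    also have "\<dots> \<le> (2 * m) * card V" using \<open>1 \<le> m\<close> by (intro mult_right_mono) auto
    finally have "real n \<le> real m * (2 * card V)"
      by (simp add: algebra_simps flip: of_nat_mult)
    then show ?thesis using False by (simp add: divide_le_eq)
  qed auto
  then have "(real n / (2 * card V)) ^ card V \<le> real m ^ card V"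
    by (rule power_mono) auto
  ultimately show ?thesis by (smt (verit) of_nat_le_iff of_nat_power)
qed

text \<open>
  Dropping injectivity of \<open>\<psi>\<close> turns the sum into a product over the vertices: each vertex
  contributes \<open>card V\<close> images of weight \<open>n\<close> and at most \<open>n\<close> images of weight \<open>1\<close>. The reward
  \<open>n\<close> for hitting the image of \<open>\<phi>\<close> thus exactly offsets its rarity.
\<close>

lemma sum_embeddings_overlap_le:
  assumes "finite V" "\<phi> \<in> vertex_embeddings V n"
  shows "(\<Sum>\<psi>\<in>vertex_embeddings V n. real n ^ card {u \<in> V. \<psi> u \<in> \<phi> ` V})
       \<le> ((real (card V) + 1) * real n) ^ card V"
proof -
  have card\<phi>: "card (\<phi> ` V) = card V" "\<phi> ` V \<subseteq> {1..n}"
    using assms(2) by (auto simp: vertex_embeddings_def PiE_iff card_image)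
  have "(\<Sum>\<psi>\<in>vertex_embeddings V n. real n ^ card {u \<in> V. \<psi> u \<in> \<phi> ` V})
      \<le> (\<Sum>\<psi>\<in>V \<rightarrow>\<^sub>E {1..n}. real n ^ card {u \<in> V. \<psi> u \<in> \<phi> ` V})"
    by (rule sum_mono2) (auto simp: vertex_embeddings_def finite_PiE assms)
  also have "\<dots> = (\<Sum>\<psi>\<in>V \<rightarrow>\<^sub>E {1..n}. \<Prod>u\<in>V. if \<psi> u \<in> \<phi> ` V then real n else 1)"
    using assms(1) by (intro sum.cong) (auto simp: prod.If_cases Int_def)
  also have "\<dots> = (\<Prod>u\<in>V. \<Sum>x\<in>{1..n}. if x \<in> \<phi> ` V then real n else 1)"
    by (rule prod_sum_PiE[symmetric]) (use assms in auto)
  also have "\<dots> = (\<Sum>x\<in>{1..n}. if x \<in> \<phi> ` V then real n else 1) ^ card V" by simp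
  also have "\<dots> \<le> ((real (card V) + 1) * real n) ^ card V"
  proof (rule power_mono)
    have "(\<Sum>x\<in>{1..n}. if x \<in> \<phi> ` V then real n else 1)
        \<le> (\<Sum>x\<in>{1..n}. (if x \<in> \<phi> ` V then real n else 0) + 1)"
      by (intro sum_mono) auto
    also have "\<dots> = (\<Sum>x\<in>{1..n}. if x \<in> \<phi> ` V then real n else 0) + real n"
      by (simp add: sum.distrib)
    also have "(\<Sum>x\<in>{1..n}. if x \<in> \<phi> ` V then real n else 0) = real n * card V"
      using card\<phi> by (simp add: sum.If_cases Int_absorb1)
    finally show "(\<Sum>x\<in>{1..n}. if x \<in> \<phi> ` V then real n else 1) \<le> (real (card V) + 1) * real n"
      by (simp add: algebra_simps)
  qed (auto intro: sum_nonneg)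
  finally show ?thesis .
qed

text \<open>
  The part of \<open>S\<close> that \<open>\<psi>\<close> places on top of the \<open>\<phi>\<close>-copy of \<open>S\<close>. It is the subcomplex \<open>T\<close> whose
  density controls the correlation of the two placements.
\<close>

lemma overlap_preimage_complex:
  assumes "abstract_simplicial_complex S"
  shows "abstract_simplicial_complex {\<sigma> \<in> S. \<psi> ` \<sigma> \<in> (`) \<phi> ` S}"
proof (rule abstract_simplicial_complexI)
  fix \<sigma> \<tau> assume \<sigma>: "\<sigma> \<in> {\<sigma> \<in> S. \<psi> ` \<sigma> \<in> (`) \<phi> ` S}" and \<tau>: "\<tau> \<subseteq> \<sigma>" "\<tau> \<noteq> {}"
  have "\<psi> ` \<tau> \<in> (`) \<phi> ` S"
    by (rule complex_face_closed[OF embedding_image_complex[OF assms], of "\<psi> ` \<sigma>"])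
      (use \<sigma> \<tau> in auto)
  then show "\<tau> \<in> {\<sigma> \<in> S. \<psi> ` \<sigma> \<in> (`) \<phi> ` S}"
    using complex_face_closed[OF assms, of \<sigma> \<tau>] \<sigma> \<tau> by simp
qed (use complex_finite_nonempty[OF assms] in auto)

text \<open>
  Counting the faces of the union gives the joint probability \<open>(q S)\<^sup>2 / q T\<close>, where \<open>q\<close> is the
  containment probability and \<open>T\<close> the overlap. The hypothesis on \<open>\<epsilon>\<close> says that
  \<open>n ^ v * q T\<close>, essentially the expected number of placements of \<open>T\<close> with its \<open>v\<close> vertices, is at
  least \<open>1 / \<epsilon>\<close> for nonempty \<open>T\<close>; hence \<open>1 / q T \<le> \<epsilon> * n ^ v\<close>. For an empty overlap the
  placements are independent, which is the summand \<open>1\<close>.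
\<close>

lemma pair_probability_le:
  fixes S :: "'v set set" and p :: "nat \<Rightarrow> real"
  assumes S: "abstract_simplicial_complex S" "finite S"
    and pos: "\<And>\<sigma>. \<sigma> \<in> S \<Longrightarrow> 0 < p (simplex_dim \<sigma>)"
    and \<epsilon>: "0 \<le> \<epsilon>" "\<And>T. subcomplex T S \<Longrightarrow> T \<noteq> {} \<Longrightarrow>
        1 \<le> \<epsilon> * (real n ^ card (\<Union>T) * (\<Prod>\<sigma>\<in>T. p (simplex_dim \<sigma>)))"
    and "1 \<le> n"
    and emb: "\<phi> \<in> vertex_embeddings (\<Union>S) n" "\<psi> \<in> vertex_embeddings (\<Union>S) n"
  shows "(\<Prod>\<sigma>\<in>(`) \<phi> ` S \<union> (`) \<psi> ` S. p (simplex_dim \<sigma>))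
    \<le> (\<Prod>\<sigma>\<in>S. p (simplex_dim \<sigma>))\<^sup>2
        * (1 + \<epsilon> * real n ^ card {u \<in> \<Union>S. \<psi> u \<in> \<phi> ` \<Union>S})"
proof -
  define q where "q K = (\<Prod>\<sigma>\<in>K. p (simplex_dim \<sigma>))" for K :: "'v set set"
  define q' where "q' K = (\<Prod>\<sigma>\<in>K. p (simplex_dim \<sigma>))" for K :: "nat set set"
  define T where "T = {\<sigma> \<in> S. \<psi> ` \<sigma> \<in> (`) \<phi> ` S}"
  define c where "c = card {u \<in> \<Union>S. \<psi> u \<in> \<phi> ` \<Union>S}"
  have finV: "finite (\<Union>S)" using S complex_finite_nonempty[OF S(1)] by blast
  have inj: "inj_on \<phi> (\<Union>S)" "inj_on \<psi> (\<Union>S)" using emb by (auto simp: vertex_embeddings_def)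
  have T: "T \<subseteq> S" "abstract_simplicial_complex T"
    using overlap_preimage_complex[OF S(1)] by (auto simp: T_def)
  have injT: "inj_on \<psi> (\<Union>T)" using inj(2) T(1) by (auto intro: inj_on_subset)
  have "(`) \<phi> ` S \<inter> (`) \<psi> ` S = (`) \<psi> ` T" unfolding T_def by blast
  then have prod: "q' ((`) \<phi> ` S \<union> (`) \<psi> ` S) * q T = (q S)\<^sup>2"
    using prod.union_inter[of "(`) \<phi> ` S" "(`) \<psi> ` S" "\<lambda>\<sigma>. p (simplex_dim \<sigma>)"] S(2)
    by (simp add: q_def q'_def prod_embedding_image inj injT power2_eq_square)
  have "0 < q T" using T(1) pos by (auto simp: q_def intro!: prod_pos)
  have "1 \<le> q T * (1 + \<epsilon> * real n ^ c)"
  proof (cases "T = {}")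
    case True
    then show ?thesis using \<epsilon>(1) by (simp add: q_def)
  next
    case False
    then have "1 \<le> \<epsilon> * (real n ^ card (\<Union>T) * q T)"
      using \<epsilon>(2) T by (simp add: q_def subcomplex_def)
    also have "card (\<Union>T) \<le> c"
      unfolding c_def
  proof (rule card_mono)
    show "finite {u \<in> \<Union>S. \<psi> u \<in> \<phi> ` \<Union>S}" using finV by (rule rev_finite_subset) blast
  qed (auto simp: T_def)
    then have "\<epsilon> * (real n ^ card (\<Union>T) * q T) \<le> \<epsilon> * (real n ^ c * q T)"
      using \<epsilon>(1) \<open>1 \<le> n\<close> \<open>0 < q T\<close>
      by (intro mult_left_mono mult_right_mono power_increasing) auto
    finally show ?thesis using \<open>0 < q T\<close> by (simp add: algebra_simps)
  qed
  then have "q' ((`) \<phi> ` S \<union> (`) \<psi> ` S) * 1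
      \<le> q' ((`) \<phi> ` S \<union> (`) \<psi> ` S) * (q T * (1 + \<epsilon> * real n ^ c))"
  proof (rule mult_left_mono)
    have "0 \<le> q' ((`) \<phi> ` S \<union> (`) \<psi> ` S) * q T" by (simp add: prod)
    then show "0 \<le> q' ((`) \<phi> ` S \<union> (`) \<psi> ` S)"
      using \<open>0 < q T\<close> by (simp add: zero_le_mult_iff)
  qed
  then have "q' ((`) \<phi> ` S \<union> (`) \<psi> ` S) \<le> (q S)\<^sup>2 * (1 + \<epsilon> * real n ^ c)"
    by (simp only: mult.assoc[symmetric] prod mult_1_right)
  then show ?thesis by (simp only: q_def q'_def c_def)
qed

lemma second_moment_embedding_count:
  assumes S: "abstract_simplicial_complex S" "\<And>\<sigma>. \<sigma> \<in> S \<Longrightarrow> simplex_dim \<sigma> \<le> r"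
  shows "(\<Sum>Y\<in>skeleton_subcomplexes r n. complex_weight r n p Y * (embedding_count S n Y)\<^sup>2)
       = (\<Sum>\<phi>\<in>vertex_embeddings (\<Union>S) n. \<Sum>\<psi>\<in>vertex_embeddings (\<Union>S) n.
            \<Prod>\<sigma>\<in>(`) \<phi> ` S \<union> (`) \<psi> ` S. p (simplex_dim \<sigma>))"
proof -
  let ?K = "skeleton_subcomplexes r n" and ?w = "complex_weight r n p"
  let ?E = "vertex_embeddings (\<Union>S) n"
  let ?I = "\<lambda>\<phi> \<psi> Y. of_bool ((`) \<phi> ` S \<union> (`) \<psi> ` S \<subseteq> Y) :: real"
  have "(\<Sum>Y\<in>?K. ?w Y * (embedding_count S n Y)\<^sup>2) = (\<Sum>Y\<in>?K. \<Sum>\<phi>\<in>?E. \<Sum>\<psi>\<in>?E. ?w Y * ?I \<phi> \<psi> Y)"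
    by (simp add: embedding_count_def power2_eq_square sum_product of_bool_conj flip: sum_distrib_left)
  also have "\<dots> = (\<Sum>\<phi>\<in>?E. \<Sum>Y\<in>?K. \<Sum>\<psi>\<in>?E. ?w Y * ?I \<phi> \<psi> Y)" by (rule sum.swap)
  also have "\<dots> = (\<Sum>\<phi>\<in>?E. \<Sum>\<psi>\<in>?E. \<Sum>Y\<in>?K. ?w Y * ?I \<phi> \<psi> Y)"
    by (intro sum.cong refl sum.swap)
  also have "\<dots> = (\<Sum>\<phi>\<in>?E. \<Sum>\<psi>\<in>?E. \<Prod>\<sigma>\<in>(`) \<phi> ` S \<union> (`) \<psi> ` S. p (simplex_dim \<sigma>))"
  proof (intro sum.cong refl)
    fix \<phi> \<psi> assume "\<phi> \<in> ?E" "\<psi> \<in> ?E"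
    then have "(`) \<phi> ` S \<in> ?K" "(`) \<psi> ` S \<in> ?K" using embedding_image_subcomplex[OF S] by auto
    then have "(`) \<phi> ` S \<union> (`) \<psi> ` S \<in> ?K"
      by (rule skeleton_subcomplexes_Un)
    from sum_weight_containing[OF this]
    show "(\<Sum>Y\<in>?K. ?w Y * ?I \<phi> \<psi> Y) = (\<Prod>\<sigma>\<in>(`) \<phi> ` S \<union> (`) \<psi> ` S. p (simplex_dim \<sigma>))"
      by (simp add: finite_skeleton_subcomplexes Int_def)
  qed
  finally show ?thesis .
qed

text \<open>
  Where \<open>X\<close> vanishes, \<open>(X - \<mu>)\<^sup>2 = \<mu>\<^sup>2\<close>, so the variance is at least \<open>\<mu>\<^sup>2\<close> times the weight of that
  set.
\<close>

lemma chebyshev_finite_sum: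
  fixes w X :: "'a \<Rightarrow> real"
  assumes "finite K" "\<And>Y. Y \<in> K \<Longrightarrow> 0 \<le> w Y" "sum w K = 1"
    and \<mu>: "(\<Sum>Y\<in>K. w Y * X Y) = \<mu>"
    and Q: "\<And>Y. Y \<in> K \<Longrightarrow> Q Y \<Longrightarrow> X Y = 0"
  shows "\<mu>\<^sup>2 * (\<Sum>Y | Y \<in> K \<and> Q Y. w Y) \<le> (\<Sum>Y\<in>K. w Y * (X Y)\<^sup>2) - \<mu>\<^sup>2"
proof -
  have "\<mu>\<^sup>2 * (\<Sum>Y | Y \<in> K \<and> Q Y. w Y) = \<mu>\<^sup>2 * (\<Sum>Y\<in>K. w Y * of_bool (Q Y))"
    using assms(1) by (simp add: Int_def)
  also have "\<dots> = (\<Sum>Y\<in>K. w Y * (\<mu>\<^sup>2 * of_bool (Q Y)))"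
    unfolding sum_distrib_left by (rule sum.cong[OF refl], rule mult.left_commute)
  also have "\<dots> \<le> (\<Sum>Y\<in>K. w Y * (X Y - \<mu>)\<^sup>2)"
    using assms(2) Q by (intro sum_mono mult_left_mono) auto
  also have "\<dots> = (\<Sum>Y\<in>K. w Y * (X Y)\<^sup>2 - 2 * \<mu> * (w Y * X Y) + \<mu>\<^sup>2 * w Y)"
    by (intro sum.cong refl) (simp add: power2_eq_square algebra_simps)
  also have "\<dots> = (\<Sum>Y\<in>K. w Y * (X Y)\<^sup>2) - \<mu>\<^sup>2"
    by (simp add: sum.distrib sum_subtractf assms(3) \<mu> power2_eq_square flip: sum_distrib_left)
  finally show ?thesis .
qed

text \<open>
  Chebyshev's inequality. The uncorrelated part of the second moment cancels against the squared
  mean; the rest, relative to the squared mean, is at most \<open>\<epsilon> * ((v + 1) * n) ^ v / N\<close> with \<open>v\<close> the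
  number of vertices and \<open>N \<ge> (n / (2 * v)) ^ v\<close> the number of placements, so \<open>n\<close> drops out.
\<close>

lemma second_moment_bound:
  assumes S: "abstract_simplicial_complex S" "finite S" "\<And>\<sigma>. \<sigma> \<in> S \<Longrightarrow> simplex_dim \<sigma> \<le> r"
    and p: "\<And>i. i \<le> r \<Longrightarrow> 0 < p i \<and> p i \<le> 1"
    and \<epsilon>: "0 \<le> \<epsilon>" "\<And>T. subcomplex T S \<Longrightarrow> T \<noteq> {} \<Longrightarrow>
        1 \<le> \<epsilon> * (real n ^ card (\<Union>T) * (\<Prod>\<sigma>\<in>T. p (simplex_dim \<sigma>)))"
    and n: "1 \<le> n" "card (\<Union>S) \<le> n"
  shows "measure (random_complex r n p) {Y \<in> space (random_complex r n p). \<not> contains_copy Y S}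
       \<le> \<epsilon> * (2 * card (\<Union>S) * (real (card (\<Union>S)) + 1)) ^ card (\<Union>S)"
proof -
  let ?K = "skeleton_subcomplexes r n" and ?w = "complex_weight r n p"
  let ?E = "vertex_embeddings (\<Union>S) n" and ?q = "\<Prod>\<sigma>\<in>S. p (simplex_dim \<sigma>)"
  define v where "v = card (\<Union>S)"
  define N where "N = real (card ?E)"
  define B where "B = ((real v + 1) * real n) ^ v"
  define P where "P = (\<Sum>Y | Y \<in> ?K \<and> \<not> contains_copy Y S. ?w Y)"
  have p': "0 \<le> p i \<and> p i \<le> 1" if "i \<le> r" for i using p[OF that] by auto
  have pos: "0 < p (simplex_dim \<sigma>)" if "\<sigma> \<in> S" for \<sigma> using S(3)[OF that] p by auto
  have finV: "finite (\<Union>S)" using S complex_finite_nonempty[OF S(1)] by blast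
  have "0 < ?q" using pos by (auto intro: prod_pos)
  have N_ge: "(real n / (2 * v)) ^ v \<le> N"
    unfolding N_def v_def by (rule card_vertex_embeddings_ge[OF finV n(2)])
  have "0 < (real n / (2 * v)) ^ v" using n(1) by (cases "v = 0") auto
  then have "0 < N" using N_ge by linarith
  have "(N * ?q)\<^sup>2 * P \<le> (\<Sum>Y\<in>?K. ?w Y * (embedding_count S n Y)\<^sup>2) - (N * ?q)\<^sup>2"
    unfolding P_def N_def
  proof (rule chebyshev_finite_sum)
    show "sum ?w ?K = 1" by (rule sum_weight_total)
  qed (auto simp: finite_skeleton_subcomplexes complex_weight_nonneg p'
      mean_embedding_count[OF S(1,3)] embedding_count_eq_0[OF S(1)])
  also have "(\<Sum>Y\<in>?K. ?w Y * (embedding_count S n Y)\<^sup>2)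
      = (\<Sum>\<phi>\<in>?E. \<Sum>\<psi>\<in>?E. \<Prod>\<sigma>\<in>(`) \<phi> ` S \<union> (`) \<psi> ` S. p (simplex_dim \<sigma>))"
    by (rule second_moment_embedding_count[OF S(1,3)])
  also have "\<dots> \<le> (\<Sum>\<phi>\<in>?E. \<Sum>\<psi>\<in>?E.
      ?q\<^sup>2 * (1 + \<epsilon> * real n ^ card {u \<in> \<Union>S. \<psi> u \<in> \<phi> ` \<Union>S}))"
    by (intro sum_mono pair_probability_le S pos \<epsilon> n)
  also have "\<dots> = (\<Sum>\<phi>\<in>?E. ?q\<^sup>2 * (N + \<epsilon> *
      (\<Sum>\<psi>\<in>?E. real n ^ card {u \<in> \<Union>S. \<psi> u \<in> \<phi> ` \<Union>S})))"
    by (simp add: N_def sum.distrib flip: sum_distrib_left)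
  also have "\<dots> \<le> (\<Sum>\<phi>\<in>?E. ?q\<^sup>2 * (N + \<epsilon> * B))"
    unfolding B_def v_def using \<epsilon>(1)
    by (intro sum_mono mult_left_mono add_left_mono sum_embeddings_overlap_le finV) auto
  also have "\<dots> = (N * ?q)\<^sup>2 + (N * ?q)\<^sup>2 * (\<epsilon> * B / N)"
    using \<open>0 < N\<close> by (simp add: N_def[symmetric] power2_eq_square field_simps)
  finally have "(N * ?q)\<^sup>2 * P \<le> (N * ?q)\<^sup>2 * (\<epsilon> * B / N)" by simp
  then have "P \<le> \<epsilon> * B / N"
    using \<open>0 < N\<close> \<open>0 < ?q\<close> by (subst (asm) mult_le_cancel_left_pos) auto
  also have "\<dots> \<le> \<epsilon> * B / (real n / (2 * v)) ^ v"
    using N_ge \<open>0 < (real n / (2 * v)) ^ v\<close> \<open>0 < N\<close> \<epsilon>(1)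
    by (intro divide_left_mono) (auto simp: B_def)
  also have "\<dots> = \<epsilon> * (((real v + 1) * real n) / (real n / (2 * v))) ^ v"
    by (simp only: B_def power_divide times_divide_eq_right)
  also have "((real v + 1) * real n) / (real n / (2 * v)) = 2 * v * (real v + 1)"
    using n(1) by simp
  finally show ?thesis
    using measure_random_complex[where Q = "\<lambda>Y. \<not> contains_copy Y S", OF p']
    by (simp add: P_def v_def)
qed

section \<open>Density domains and powers of the number of vertices\<close>

definition weighted_face_count :: "nat \<Rightarrow> (nat \<Rightarrow> real) \<Rightarrow> 'v set set \<Rightarrow> real" where
  "weighted_face_count r \<alpha> T = (\<Sum>i=0..r. \<alpha> i * real (face_count i T))"

lemma prod_power_parameter:
  assumes "finite T" "\<And>\<sigma>. \<sigma> \<in> T \<Longrightarrow> simplex_dim \<sigma> \<le> r" "1 \<le> n"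
  shows "(\<Prod>\<sigma>\<in>T. power_parameter \<alpha> n (simplex_dim \<sigma>)) = real n powr (- weighted_face_count r \<alpha> T)"
proof -
  have "(\<Prod>\<sigma>\<in>T. power_parameter \<alpha> n (simplex_dim \<sigma>))
      = (\<Prod>i=0..r. power_parameter \<alpha> n i ^ face_count i T)"
    unfolding face_count_def using assms by (intro prod_by_simplex_dim[symmetric])
  also have "\<dots> = (\<Prod>i=0..r. real n powr (- (\<alpha> i * face_count i T)))"
    using assms(3)
    by (intro prod.cong refl) (simp add: power_parameter_def powr_powr flip: powr_realpow)
  also have "\<dots> = real n powr (\<Sum>i=0..r. - (\<alpha> i * face_count i T))"
    using assms(3) by (intro powr_sum[symmetric]) auto
  finally show ?thesis by (simp add: weighted_face_count_def sum_negf)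
qed

text \<open>
  Multiplying the defining inequality by the number of vertices removes the ratios, including the
  infinite ones, which belong to face numbers equal to \<open>0\<close>.
\<close>

lemma density_domain_iff:
  assumes T: "abstract_simplicial_complex T" "finite T" "T \<noteq> {}"
    and \<alpha>: "\<alpha> \<in> topspace (Euclidean_space (Suc r))" "\<forall>i\<le>r. 0 \<le> \<alpha> i"
  shows "\<alpha> \<in> density_domain r T \<longleftrightarrow> weighted_face_count r \<alpha> T < card (\<Union>T)"
proof -
  have "finite (\<Union>T)" "\<Union>T \<noteq> {}" using T complex_finite_nonempty[OF T(1)] by auto
  then have "0 < face_count 0 T" by (simp add: face_count_zero_eq_card_vertices[OF T(1)] card_gt_0_iff)
  then have "ereal (\<alpha> i) / vertex_face_ratio i T = ereal (\<alpha> i * face_count i T / face_count 0 T)" for i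
    by (simp add: vertex_face_ratio_def)
  then have "(\<Sum>i=0..r. ereal (\<alpha> i) / vertex_face_ratio i T)
      = ereal (weighted_face_count r \<alpha> T / face_count 0 T)"
    by (simp add: weighted_face_count_def sum_divide_distrib)
  then show ?thesis
    using \<alpha> \<open>0 < face_count 0 T\<close> face_count_zero_eq_card_vertices[OF T(1)]
    by (simp add: density_domain_def divide_less_eq)
qed

text \<open>
  The functions that define the domain are linear, and a nonempty \<open>T\<close> has at least one vertex, so
  shrinking \<open>\<alpha>\<close> by a factor \<open>t < 1\<close> makes every weak inequality strict.
\<close>

lemma in_closure_reduced_density_domain:
  assumes S: "abstract_simplicial_complex S" "finite S"
    and \<alpha>: "\<alpha> \<in> topspace (Euclidean_space (Suc r))" "\<forall>i\<le>r. 0 \<le> \<alpha> i"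
    and le: "\<And>T. subcomplex T S \<Longrightarrow> T \<noteq> {} \<Longrightarrow> weighted_face_count r \<alpha> T \<le> card (\<Union>T)"
  shows "\<alpha> \<in> Euclidean_space (Suc r) closure_of reduced_density_domain r S"
proof -
  define f where "f t = (\<lambda>i. t * \<alpha> i)" for t :: real
  have "continuous_map euclideanreal (Euclidean_space (Suc r)) f"
    using \<alpha>(1) unfolding Euclidean_space_def continuous_map_in_subtopology
      continuous_map_componentwise_UNIV
    by (auto simp: f_def intro!: continuous_intros)
  then have "f ` (euclideanreal closure_of {0..<1})
      \<subseteq> Euclidean_space (Suc r) closure_of f ` {0..<1}"
    by (rule continuous_map_image_closure_subset)
  moreover have "1 \<in> euclideanreal closure_of {0..<1::real}" by simp
  moreover have "f 1 = \<alpha>" by (simp add: f_def)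
  ultimately have "\<alpha> \<in> Euclidean_space (Suc r) closure_of f ` {0..<1}" by blast
  moreover have "f ` {0..<1} \<subseteq> reduced_density_domain r S"
  proof (clarsimp simp: reduced_density_domain_def)
    fix t :: real and T assume t: "0 \<le> t" "t < 1" and T: "subcomplex T S" "T \<noteq> {}"
    have T': "abstract_simplicial_complex T" "finite T"
      using T S finite_subset by (auto simp: subcomplex_def)
    have ft: "f t \<in> topspace (Euclidean_space (Suc r))" "\<forall>i\<le>r. 0 \<le> f t i"
      using \<alpha> t by (auto simp: f_def topspace_Euclidean_space)
    have "finite (\<Union>T)" "\<Union>T \<noteq> {}" using T' T(2) complex_finite_nonempty[OF T'(1)] by auto
    then have "0 < real (card (\<Union>T))" by (simp add: card_gt_0_iff)
    have "weighted_face_count r (f t) T = t * weighted_face_count r \<alpha> T"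
      by (simp add: weighted_face_count_def f_def sum_distrib_left mult.assoc)
    also have "\<dots> \<le> t * card (\<Union>T)" using le[OF T] t by (intro mult_left_mono) auto
    also have "\<dots> < card (\<Union>T)" using t \<open>0 < real (card (\<Union>T))\<close> by simp
    finally show "f t \<in> density_domain r T"
      using density_domain_iff[OF T' T(2) ft] by simp
  qed
  ultimately show ?thesis using closure_of_mono by blast
qed

lemma power_parameter_bounds:
  assumes "0 \<le> \<alpha> i" "1 \<le> n"
  shows "0 < power_parameter \<alpha> n i" "power_parameter \<alpha> n i \<le> 1"
  using assms powr_mono[of "- \<alpha> i" 0 "real n"] by (auto simp: power_parameter_def)

lemma tendsto_nat_powr_neg:
  assumes "0 < (\<delta>::real)"
  shows "(\<lambda>n. real n powr - \<delta>) \<longlonglongrightarrow> 0"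
  using assms by (intro tendsto_neg_powr filterlim_real_sequentially) simp

lemma asymptotically_almost_surelyI:
  assumes \<alpha>: "\<forall>i\<le>r. 0 \<le> \<alpha> i"
    and bound: "\<And>n. 1 \<le> n \<Longrightarrow> m \<le> n \<Longrightarrow>
      measure (random_complex r n (power_parameter \<alpha> n))
        {Y \<in> space (random_complex r n (power_parameter \<alpha> n)). \<not> Q Y} \<le> C * real n powr - \<delta>"
    and \<delta>: "0 < \<delta>"
  shows "asymptotically_almost_surely (\<lambda>n. random_complex r n (power_parameter \<alpha> n)) Q"
proof -
  define f where "f n = measure (random_complex r n (power_parameter \<alpha> n))
        {Y \<in> space (random_complex r n (power_parameter \<alpha> n)). \<not> Q Y}" for n
  have "f \<longlonglongrightarrow> 0"
  proof (rule tendsto_sandwich[of "\<lambda>_. 0"])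
    show "\<forall>\<^sub>F n in sequentially. f n \<le> C * real n powr - \<delta>"
      using eventually_ge_at_top[of 1] eventually_ge_at_top[of m]
      by eventually_elim (use bound in \<open>auto simp: f_def\<close>)
    show "(\<lambda>n. C * real n powr - \<delta>) \<longlonglongrightarrow> 0"
      using tendsto_mult_right_zero[OF tendsto_nat_powr_neg[OF \<delta>]] .
  qed (auto simp: f_def)
  then have "(\<lambda>n. 1 - f n) \<longlonglongrightarrow> 1" using tendsto_diff[OF tendsto_const[of 1], of f 0] by simp
  moreover have "\<forall>\<^sub>F n in sequentially. 1 - f n = measure (random_complex r n (power_parameter \<alpha> n))
        {Y \<in> space (random_complex r n (power_parameter \<alpha> n)). Q Y}"
    using eventually_ge_at_top[of 1]
  proof eventually_elim
    case (elim n)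
    have "0 \<le> power_parameter \<alpha> n i \<and> power_parameter \<alpha> n i \<le> 1" if "i \<le> r" for i
      using power_parameter_bounds[of \<alpha> i n] \<alpha> that elim by auto
    from measure_random_complex_not[OF this] show ?case by (simp add: f_def)
  qed
  ultimately show ?thesis
    unfolding asymptotically_almost_surely_def by (rule Lim_transform_eventually)
qed

section \<open>The containment threshold\<close>

text \<open>
  Since \<open>S\<close> has finitely many subcomplexes, the strict inequalities hold with a common gap \<open>\<delta>\<close>, and
  the second moment bound applies with \<open>\<epsilon> = n powr - \<delta>\<close>.
\<close>

lemma contains_copy_aas:
  assumes S: "abstract_simplicial_complex S" "finite S" "\<And>\<sigma>. \<sigma> \<in> S \<Longrightarrow> simplex_dim \<sigma> \<le> r"
    and \<alpha>: "\<forall>i\<le>r. 0 \<le> \<alpha> i"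
    and less: "\<And>T. subcomplex T S \<Longrightarrow> T \<noteq> {} \<Longrightarrow> weighted_face_count r \<alpha> T < card (\<Union>T)"
  shows "asymptotically_almost_surely
           (\<lambda>n. random_complex r n (power_parameter \<alpha> n)) (\<lambda>Y. contains_copy Y S)"
proof -
  define g where "g T = real (card (\<Union>T)) - weighted_face_count r \<alpha> T" for T :: "'a set set"
  \<comment> \<open>The extra element \<open>1\<close> keeps the minimum meaningful when \<open>S\<close> is empty.\<close>
  define D where "D = insert 1 (g ` {T. subcomplex T S \<and> T \<noteq> {}})"
  define \<delta> where "\<delta> = Min D"
  have "finite {T. subcomplex T S \<and> T \<noteq> {}}"
    by (rule finite_subset[of _ "Pow S"]) (auto simp: subcomplex_def S(2))
  then have D: "finite D" "D \<noteq> {}" by (auto simp: D_def)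
  have "0 < d" if "d \<in> D" for d
    using that less unfolding D_def g_def by (elim insertE imageE) auto
  then have "0 < \<delta>" using D by (simp add: \<delta>_def)
  have \<delta>_le: "\<delta> \<le> g T" if "subcomplex T S" "T \<noteq> {}" for T
    using D that by (auto simp: \<delta>_def D_def intro: Min_le)
  define C where "C = (2 * card (\<Union>S) * (real (card (\<Union>S)) + 1)) ^ card (\<Union>S)"
  show ?thesis
  proof (rule asymptotically_almost_surelyI[OF \<alpha> _ \<open>0 < \<delta>\<close>, where m = "card (\<Union>S)" and C = C])
    fix n assume n: "1 \<le> n" "card (\<Union>S) \<le> n"
    have "measure (random_complex r n (power_parameter \<alpha> n))
        {Y \<in> space (random_complex r n (power_parameter \<alpha> n)). \<not> contains_copy Y S}
      \<le> real n powr - \<delta> * (2 * card (\<Union>S) * (real (card (\<Union>S)) + 1)) ^ card (\<Union>S)"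
    proof (rule second_moment_bound[OF S])
      fix T assume T: "subcomplex T S" "T \<noteq> {}"
      have T': "T \<subseteq> S" using T by (simp add: subcomplex_def)
      have "(\<Prod>\<sigma>\<in>T. power_parameter \<alpha> n (simplex_dim \<sigma>)) = real n powr - weighted_face_count r \<alpha> T"
        by (rule prod_power_parameter) (use S T' n finite_subset in auto)
      then have "real n powr - \<delta> * (real n ^ card (\<Union>T) *
          (\<Prod>\<sigma>\<in>T. power_parameter \<alpha> n (simplex_dim \<sigma>))) = real n powr (g T - \<delta>)"
        using n(1) by (simp add: g_def flip: powr_realpow powr_add)
      also have "1 \<le> real n powr (g T - \<delta>)"
        using \<delta>_le[OF T] n(1) by (intro ge_one_powr_ge_zero) auto
      finally show "1 \<le> real n powr - \<delta> * (real n ^ card (\<Union>T) *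
          (\<Prod>\<sigma>\<in>T. power_parameter \<alpha> n (simplex_dim \<sigma>)))" .
    qed (use n \<alpha> power_parameter_bounds in auto)
    then show "measure (random_complex r n (power_parameter \<alpha> n))
        {Y \<in> space (random_complex r n (power_parameter \<alpha> n)). \<not> contains_copy Y S}
      \<le> C * real n powr - \<delta>" by (simp add: C_def mult.commute)
  qed
qed

text \<open>
  A subcomplex can be too dense even when \<open>S\<close> as a whole is not, so the first moment is taken for
  \<open>T\<close>: a copy of \<open>S\<close> contains one of \<open>T\<close>.
\<close>

lemma not_contains_copy_aas:
  assumes S: "abstract_simplicial_complex S" "finite S" "\<And>\<sigma>. \<sigma> \<in> S \<Longrightarrow> simplex_dim \<sigma> \<le> r"
    and \<alpha>: "\<forall>i\<le>r. 0 \<le> \<alpha> i"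
    and T: "subcomplex T S" "card (\<Union>T) < weighted_face_count r \<alpha> T"
  shows "asymptotically_almost_surely
           (\<lambda>n. random_complex r n (power_parameter \<alpha> n)) (\<lambda>Y. \<not> contains_copy Y S)"
proof -
  define \<delta> where "\<delta> = weighted_face_count r \<alpha> T - real (card (\<Union>T))"
  have "0 < \<delta>" using T(2) by (simp add: \<delta>_def)
  have T': "abstract_simplicial_complex T" "T \<subseteq> S" "finite T"
    using T(1) S(2) finite_subset by (auto simp: subcomplex_def)
  have dimT: "simplex_dim \<sigma> \<le> r" if "\<sigma> \<in> T" for \<sigma> using S(3) T'(2) that by auto
  show ?thesis
  proof (rule asymptotically_almost_surelyI[OF \<alpha> _ \<open>0 < \<delta>\<close>, where m = 0 and C = 1])
    fix n :: nat assume n: "1 \<le> n"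
    let ?p = "power_parameter \<alpha> n"
    have p: "0 \<le> ?p i \<and> ?p i \<le> 1" if "i \<le> r" for i
      using power_parameter_bounds[of \<alpha> i n] \<alpha> that n by auto
    have "measure (random_complex r n ?p) {Y \<in> space (random_complex r n ?p). contains_copy Y S}
        \<le> measure (random_complex r n ?p) {Y \<in> space (random_complex r n ?p). contains_copy Y T}"
      using contains_copy_mono[OF S(1) T(1)]
      by (simp add: measure_random_complex[OF p])
        (intro sum_mono2; auto simp: finite_skeleton_subcomplexes complex_weight_nonneg p)
    also have "\<dots> \<le> real n ^ card (\<Union>T) * (\<Prod>\<sigma>\<in>T. ?p (simplex_dim \<sigma>))"
      by (rule first_moment_bound[OF T'(1,3) dimT p])
    also have "\<dots> = real n powr - \<delta>"
      using n prod_power_parameter[OF T'(3) dimT n]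
      by (simp add: \<delta>_def flip: powr_realpow powr_add)
    finally show "measure (random_complex r n ?p)
        {Y \<in> space (random_complex r n ?p). \<not> \<not> contains_copy Y S} \<le> 1 * real n powr - \<delta>"
      by simp
  qed
qed

theorem lemma3p5:
  fixes r :: nat and S :: "'v set set" and \<alpha> :: "nat \<Rightarrow> real"
  assumes "r \<ge> 1"
    and "abstract_simplicial_complex S" and "finite S" and "S \<noteq> {}"
    and "complex_dim S \<le> r"
    and "\<alpha> \<in> topspace (Euclidean_space (Suc r))"
    and "\<forall>i\<le>r. 0 \<le> \<alpha> i"
  shows "(\<alpha> \<in> reduced_density_domain r S \<longrightarrow>
            asymptotically_almost_surely
              (\<lambda>n. random_complex r n (power_parameter \<alpha> n)) (\<lambda>Y. contains_copy Y S)) \<and>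
         (\<alpha> \<notin> Euclidean_space (Suc r) closure_of reduced_density_domain r S \<longrightarrow>
            asymptotically_almost_surely
              (\<lambda>n. random_complex r n (power_parameter \<alpha> n)) (\<lambda>Y. \<not> contains_copy Y S))"
proof -
  have dim: "simplex_dim \<sigma> \<le> r" if "\<sigma> \<in> S" for \<sigma>
    using Max_ge[of "simplex_dim ` S" "simplex_dim \<sigma>"] that assms(3,5)
    unfolding complex_dim_def by (meson finite_imageI imageI order_trans)
  have "asymptotically_almost_surely
      (\<lambda>n. random_complex r n (power_parameter \<alpha> n)) (\<lambda>Y. contains_copy Y S)"
    if "\<alpha> \<in> reduced_density_domain r S"
  proof (rule contains_copy_aas[OF assms(2,3) dim assms(7)])
    fix T assume T: "subcomplex T S" "T \<noteq> {}"
    then have "abstract_simplicial_complex T" "finite T"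
      using assms(3) finite_subset by (auto simp: subcomplex_def)
    moreover have "\<alpha> \<in> density_domain r T" using that T by (auto simp: reduced_density_domain_def)
    ultimately show "weighted_face_count r \<alpha> T < card (\<Union>T)"
      using density_domain_iff T(2) assms(6,7) by blast
  qed
  moreover have "asymptotically_almost_surely
      (\<lambda>n. random_complex r n (power_parameter \<alpha> n)) (\<lambda>Y. \<not> contains_copy Y S)"
    if out: "\<alpha> \<notin> Euclidean_space (Suc r) closure_of reduced_density_domain r S"
  proof -
    obtain T where T: "subcomplex T S" "card (\<Union>T) < weighted_face_count r \<alpha> T"
      using in_closure_reduced_density_domain[OF assms(2,3,6,7)] out by force
    show ?thesis by (rule not_contains_copy_aas[OF assms(2,3) dim assms(7) T])
  qed
  ultimately show ?thesis by blast
qed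

end
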